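(* Let $g>0$, $H>0$, $U>0$, $\Omega=[x_L,x_R]$, and let $h,u$ be a sufficiently smooth real-valued solution on $\Omega\times[0,\infty)$ of the linearized Serre equations $$\frac{\partial h}{\partial t}+\frac{\partial}{\partial x}(Hu+Uh)=0,\qquad \frac{\partial u}{\partial t}+\frac{\partial}{\partial x}\left(gh+Uu-\frac{H^2U}{3}\frac{\partial^2u}{\partial x^2}-\frac{H^2}{3}\frac{\partial^2u}{\partial x\partial t}\right)=0,$$ with sufficiently smooth, compactly supported initial data $h(x,0)=f_h(x)$, $u(x,0)=f_u(x)$, and satisfying for all $t\ge0$ the boundary conditions $$w_2(x_L,t)=\alpha_2w_5(x_L,t),\quad w_3(x_L,t)=\alpha_3w_5(x_L,t),\quad w_4(x_L,t)=\alpha_4w_5(x_L,t),$$ $$w_5(x_R,t)=\beta_2w_2(x_R,t)+\beta_3w_3(x_R,t)+\beta_4w_4(x_R,t).$$ Let $$\mathbf R=\begin{bmatrix}\lambda_2+\beta_2^2\lambda_5&\beta_2\beta_3\lambda_5&\beta_2\beta_4\lambda_5\\ \beta_2\beta_3\lambda_5&\lambda_3+\beta_3^2\lambda_5&\beta_3\beta_4\lambda_5\\ \beta_2\beta_4\lambda_5&\beta_3\beta_4\lambda_5&\lambda_4+\beta_4^2\lambda_5\end{bmatrix}.$$ If the real constants $\alpha_j,\beta_j$ ($j=2,3,4$) are chosen such that $\mathbf v^{\top}\mathbf R\mathbf v\le0$ for all $\mathbf v\in\mathbb R^3$ and $\lambda_2\alpha_2^2+\lambda_3\alpha_3^2+\lambda_4\alpha_4^2+\lambda_5\ge0$,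 then $E(t)\le E(0)$ for all $t\ge0$.
   Context: The energy is $E(t)=\frac g2\|h\|^2_{L^2(\Omega)}+\frac H2\|u\|^2_{L^2(\Omega)}+\frac{H^3}{6}\left\|\frac{\partial u}{\partial x}\right\|^2_{L^2(\Omega)}$. Put $S=\sqrt{4H^4+9U^2}$, $C^{\pm}=\sqrt{4H^4+(3U\pm S)^2}$. The boundary variables are $w_2=\frac{\partial u}{\partial x}$, $w_3=h$, $$w_4=\frac1{C^+}\left(2H^2U\frac{\partial^2u}{\partial x^2}+2H^2\frac{\partial^2u}{\partial x\partial t}-6gh-(3U+S)u\right),\quad w_5=\frac1{C^-}\left(2H^2U\frac{\partial^2u}{\partial x^2}+2H^2\frac{\partial^2u}{\partial x\partial t}-6gh-(3U-S)u\right),$$ and $\lambda_2=-\frac{H^3U}{6}$, $\lambda_3=-\frac{gU}{2}$, $\lambda_4=-\frac{HU}{4}-\frac{HS}{12}$, $\lambda_5=-\frac{HU}{4}+\frac{HS}{12}$. "Sufficiently smooth" means that all partial derivatives appearing exist, are continuous on $\Omega\times[0,\infty)$, and mixed partials commute. *)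

theory Defs
  imports "HOL-Analysis.Analysis"
begin

text \<open>
  Functions of space and time are curried, \<open>f x t\<close>, and are total, but only their values on
  \<open>{xL..xR} \<times> {0..}\<close> matter: partial derivatives are taken within that domain, hence are
  one-sided at \<open>x = xL\<close>, \<open>x = xR\<close> and \<open>t = 0\<close>.
\<close>

definition dx :: "real \<Rightarrow> real \<Rightarrow> (real \<Rightarrow> real \<Rightarrow> real) \<Rightarrow> real \<Rightarrow> real \<Rightarrow> real" where
  "dx xL xR f x t = vector_derivative (\<lambda>y. f y t) (at x within {xL..xR})"

definition dt :: "(real \<Rightarrow> real \<Rightarrow> real) \<Rightarrow> real \<Rightarrow> real \<Rightarrow> real" where
  "dt f x t = vector_derivative (\<lambda>s. f x s) (at t within {0..})"

definition cont_dom :: "real \<Rightarrow> real \<Rightarrow> (real \<Rightarrow> real \<Rightarrow> real) \<Rightarrow> bool" where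
  "cont_dom xL xR f \<longleftrightarrow> continuous_on ({xL..xR} \<times> {0..}) (\<lambda>(x, t). f x t)"

definition C_dx :: "real \<Rightarrow> real \<Rightarrow> (real \<Rightarrow> real \<Rightarrow> real) \<Rightarrow> bool" where
  "C_dx xL xR f \<longleftrightarrow>
     (\<forall>x\<in>{xL..xR}. \<forall>t\<ge>0. (\<lambda>y. f y t) differentiable (at x within {xL..xR}))
     \<and> cont_dom xL xR (dx xL xR f)"

definition C_dt :: "real \<Rightarrow> real \<Rightarrow> (real \<Rightarrow> real \<Rightarrow> real) \<Rightarrow> bool" where
  "C_dt xL xR f \<longleftrightarrow>
     (\<forall>x\<in>{xL..xR}. \<forall>t\<ge>0. (\<lambda>s. f x s) differentiable (at t within {0..}))
     \<and> cont_dom xL xR (dt f)"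

text \<open>The derivatives occurring in the equations are \<open>h_t, h_x\<close> and
  \<open>u_t, u_x, u_xx, u_xt, u_xxx, u_xxt\<close>; the mixed ones exist in every order of differentiation,
  and all orders agree.\<close>

definition smooth_h :: "real \<Rightarrow> real \<Rightarrow> (real \<Rightarrow> real \<Rightarrow> real) \<Rightarrow> bool" where
  "smooth_h xL xR h \<longleftrightarrow> cont_dom xL xR h \<and> C_dx xL xR h \<and> C_dt xL xR h"

definition smooth_u :: "real \<Rightarrow> real \<Rightarrow> (real \<Rightarrow> real \<Rightarrow> real) \<Rightarrow> bool" where
  "smooth_u xL xR u \<longleftrightarrow>
     (let D = dx xL xR in
        cont_dom xL xR u \<and> C_dx xL xR u \<and> C_dt xL xR u
      \<and> C_dx xL xR (D u) \<and> C_dx xL xR (dt u) \<and> C_dt xL xR (D u)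
      \<and> C_dx xL xR (D (D u))
      \<and> C_dx xL xR (D (dt u)) \<and> C_dx xL xR (dt (D u)) \<and> C_dt xL xR (D (D u))
      \<and> (\<forall>x\<in>{xL..xR}. \<forall>t\<ge>0.
            dt (D u) x t = D (dt u) x t
          \<and> D (dt (D u)) x t = D (D (dt u)) x t
          \<and> dt (D (D u)) x t = D (D (dt u)) x t))"

definition linearized_serre ::
  "real \<Rightarrow> real \<Rightarrow> real \<Rightarrow> real \<Rightarrow> real \<Rightarrow> (real \<Rightarrow> real \<Rightarrow> real) \<Rightarrow> (real \<Rightarrow> real \<Rightarrow> real) \<Rightarrow> bool" where
  "linearized_serre g H U xL xR h u \<longleftrightarrow>
     (\<forall>x\<in>{xL..xR}. \<forall>t\<ge>0.
        dt h x t + dx xL xR (\<lambda>x t. H * u x t + U * h x t) x t = 0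
      \<and> dt u x t
        + dx xL xR (\<lambda>x t. g * h x t + U * u x t
                        - H^2 * U / 3 * dx xL xR (dx xL xR u) x t
                        - H^2 / 3 * dx xL xR (dt u) x t) x t = 0)"

definition Ck_compact_support :: "nat \<Rightarrow> (real \<Rightarrow> real) \<Rightarrow> bool" where
  "Ck_compact_support k f \<longleftrightarrow>
     (\<forall>j<k. (deriv ^^ j) f differentiable_on UNIV) \<and> continuous_on UNIV ((deriv ^^ k) f)
     \<and> compact (closure {x. f x \<noteq> 0})"

definition L2_norm_on :: "real \<Rightarrow> real \<Rightarrow> (real \<Rightarrow> real) \<Rightarrow> real" where
  "L2_norm_on xL xR f = sqrt (LINT x:{xL..xR}|lebesgue. (f x)^2)"

definition energy ::
  "real \<Rightarrow> real \<Rightarrow> real \<Rightarrow> real \<Rightarrow> (real \<Rightarrow> real \<Rightarrow> real) \<Rightarrow> (real \<Rightarrow> real \<Rightarrow> real) \<Rightarrow> real \<Rightarrow> real" where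
  "energy g H xL xR h u t =
     g / 2 * (L2_norm_on xL xR (\<lambda>x. h x t))^2
     + H / 2 * (L2_norm_on xL xR (\<lambda>x. u x t))^2
     + H^3 / 6 * (L2_norm_on xL xR (\<lambda>x. dx xL xR u x t))^2"

definition S_const :: "real \<Rightarrow> real \<Rightarrow> real" where
  "S_const H U = sqrt (4 * H^4 + 9 * U^2)"

definition C_plus :: "real \<Rightarrow> real \<Rightarrow> real" where
  "C_plus H U = sqrt (4 * H^4 + (3 * U + S_const H U)^2)"

definition C_minus :: "real \<Rightarrow> real \<Rightarrow> real" where
  "C_minus H U = sqrt (4 * H^4 + (3 * U - S_const H U)^2)"

definition w2 :: "real \<Rightarrow> real \<Rightarrow> (real \<Rightarrow> real \<Rightarrow> real) \<Rightarrow> real \<Rightarrow> real \<Rightarrow> real" where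
  "w2 xL xR u x t = dx xL xR u x t"

definition w3 :: "(real \<Rightarrow> real \<Rightarrow> real) \<Rightarrow> real \<Rightarrow> real \<Rightarrow> real" where
  "w3 h x t = h x t"

definition w4 ::
  "real \<Rightarrow> real \<Rightarrow> real \<Rightarrow> real \<Rightarrow> real \<Rightarrow> (real \<Rightarrow> real \<Rightarrow> real) \<Rightarrow> (real \<Rightarrow> real \<Rightarrow> real)
     \<Rightarrow> real \<Rightarrow> real \<Rightarrow> real" where
  "w4 g H U xL xR h u x t =
     1 / C_plus H U *
       (2 * H^2 * U * dx xL xR (dx xL xR u) x t + 2 * H^2 * dx xL xR (dt u) x t
        - 6 * g * h x t - (3 * U + S_const H U) * u x t)"

definition w5 ::
  "real \<Rightarrow> real \<Rightarrow> real \<Rightarrow> real \<Rightarrow> real \<Rightarrow> (real \<Rightarrow> real \<Rightarrow> real) \<Rightarrow> (real \<Rightarrow> real \<Rightarrow> real)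
     \<Rightarrow> real \<Rightarrow> real \<Rightarrow> real" where
  "w5 g H U xL xR h u x t =
     1 / C_minus H U *
       (2 * H^2 * U * dx xL xR (dx xL xR u) x t + 2 * H^2 * dx xL xR (dt u) x t
        - 6 * g * h x t - (3 * U - S_const H U) * u x t)"

definition lambda2 :: "real \<Rightarrow> real \<Rightarrow> real" where
  "lambda2 H U = - (H^3 * U / 6)"

definition lambda3 :: "real \<Rightarrow> real \<Rightarrow> real" where
  "lambda3 g U = - (g * U / 2)"

definition lambda4 :: "real \<Rightarrow> real \<Rightarrow> real" where
  "lambda4 H U = - (H * U / 4) - H * S_const H U / 12"

definition lambda5 :: "real \<Rightarrow> real \<Rightarrow> real" where
  "lambda5 H U = - (H * U / 4) + H * S_const H U / 12"

definition R_matrix :: "real \<Rightarrow> real \<Rightarrow> real \<Rightarrow> real \<Rightarrow> real \<Rightarrow> real \<Rightarrow> real^3^3" where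
  "R_matrix g H U \<beta>2 \<beta>3 \<beta>4 =
     (let l5 = lambda5 H U in
      vector
       [vector [lambda2 H U + \<beta>2^2 * l5, \<beta>2 * \<beta>3 * l5,            \<beta>2 * \<beta>4 * l5],
        vector [\<beta>2 * \<beta>3 * l5,            lambda3 g U + \<beta>3^2 * l5, \<beta>3 * \<beta>4 * l5],
        vector [\<beta>2 * \<beta>4 * l5,            \<beta>3 * \<beta>4 * l5,            lambda4 H U + \<beta>4^2 * l5]])"

end

theory Submission
  imports Defs
begin

text \<open>
  Energy method. By the equations, the integrand of \<open>E'(t)\<close> is the \<open>x\<close>-derivative of the flux
  \<open>F = - g U h^2 / 2 - H^3 U u_x^2 / 6 + H u q / 6 - H U u^2 / 2\<close> with
  \<open>q = 2 H^2 U u_xx + 2 H^2 u_xt - 6 g h\<close>, so \<open>E'(t) = F(xR, t) - F(xL, t)\<close>.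
  The variables \<open>w2, ..., w5\<close> diagonalise the flux: \<open>F\<close> is the sum of the \<open>lambda_i w_i^2\<close>.
  The boundary conditions turn \<open>F\<close> at \<open>xR\<close> into the quadratic form of \<open>R\<close>, which is nonpositive,
  and \<open>F\<close> at \<open>xL\<close> into a nonnegative multiple of \<open>w5^2\<close>.
\<close>

lemma cont_dom_continuous_on_x:
  assumes "cont_dom xL xR f" "t \<ge> 0"
  shows "continuous_on {xL..xR} (\<lambda>x. f x t)"
proof -
  have "continuous_on {xL..xR} ((\<lambda>(x, t). f x t) \<circ> (\<lambda>x. (x, t)))"
    using assms unfolding cont_dom_def
    by (intro continuous_on_compose continuous_intros)
       (auto elim!: continuous_on_subset)
  then show ?thesis by (simp add: o_def)
qed

lemma C_dx_has_derivative:
  assumes "C_dx xL xR f" "x \<in> {xL..xR}" "t \<ge> 0"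
  shows "((\<lambda>y. f y t) has_real_derivative dx xL xR f x t) (at x within {xL..xR})"
  using assms
  by (simp add: C_dx_def dx_def vector_derivative_works has_real_derivative_iff_has_vector_derivative)

lemma C_dt_has_derivative:
  assumes "C_dt xL xR f" "x \<in> {xL..xR}" "t \<ge> 0"
  shows "((\<lambda>s. f x s) has_real_derivative dt f x t) (at t within {0..})"
  using assms
  by (simp add: C_dt_def dt_def vector_derivative_works has_real_derivative_iff_has_vector_derivative)

text \<open>For \<open>xL < xR\<close> no point of the interval is isolated, so a derivative within
  it is unique, also at the end points.\<close>

lemma dx_eqI:
  assumes "xL < xR" "x \<in> {xL..xR}"
    and "((\<lambda>y. f y t) has_real_derivative D) (at x within {xL..xR})"
  shows "dx xL xR f x t = D"
  using assms vector_derivative_within_cbox[of xL xR x "\<lambda>y. f y t" D]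
  by (simp add: dx_def has_real_derivative_iff_has_vector_derivative)

text \<open>For continuous \<open>f\<close> the Lebesgue and gauge integrals agree, and
  nonnegativity lets the square undo the root.\<close>

lemma L2_norm_on_squared:
  assumes "continuous_on {a..b} f"
  shows "(L2_norm_on a b f)^2 = integral {a..b} (\<lambda>x. (f x)^2)"
proof -
  have cont: "continuous_on {a..b} (\<lambda>x. (f x)^2)"
    using assms by (intro continuous_intros)
  have "(LINT x:{a..b}|lebesgue. (f x)^2) = integral {a..b} (\<lambda>x. (f x)^2)"
    using cont by (intro set_lebesgue_integral_eq_integral absolutely_integrable_continuous_real)
  moreover have "0 \<le> integral {a..b} (\<lambda>x. (f x)^2)"
    using cont by (intro integral_nonneg integrable_continuous_real) auto
  ultimately show ?thesis
    by (simp add: L2_norm_on_def)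
qed

text \<open>Leibniz rule: \<open>2 * f * dt f\<close> is jointly continuous on the domain, so
  differentiation passes under the integral, one-sidedly at time 0.\<close>

lemma integral_square_has_derivative:
  assumes "cont_dom xL xR f" "C_dt xL xR f" "t \<ge> 0"
  shows "((\<lambda>s. integral {xL..xR} (\<lambda>x. (f x s)^2)) has_real_derivative
            integral {xL..xR} (\<lambda>x. 2 * f x t * dt f x t)) (at t within {0..})"
proof -
  \<comment> \<open>The Leibniz rule expects the parameter (time) as first coordinate, whereas
    \<open>cont_dom\<close> puts space first.\<close>
  have swap: "continuous_on ({0..} \<times> {xL..xR}) (\<lambda>(s, x). k x s)"
    if "cont_dom xL xR k" for k
  proof -
    have "continuous_on ({0..} \<times> {xL..xR}) ((\<lambda>(x, s). k x s) \<circ> prod.swap)"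
      using that unfolding cont_dom_def
      by (intro continuous_on_compose continuous_on_swap)
         (auto simp: product_swap)
    then show ?thesis by (simp add: o_def case_prod_beta)
  qed
  have "continuous_on ({0..} \<times> cbox xL xR) (\<lambda>(s, x). 2 * f x s * dt f x s)"
    using swap[of f] swap[of "dt f"] assms
    by (auto simp: C_dt_def case_prod_beta intro!: continuous_intros)
  moreover have "((\<lambda>s. (f x s)^2) has_real_derivative 2 * f x s * dt f x s) (at s within {0..})"
    if "s \<in> {0..}" "x \<in> cbox xL xR" for s x
    using that by (auto intro!: derivative_eq_intros C_dt_has_derivative[OF assms(2)])
  moreover have "(\<lambda>x. (f x s)^2) integrable_on cbox xL xR" if "s \<in> {0..}" for s
    using that cont_dom_continuous_on_x[OF assms(1), of s]
    by (intro integrable_continuous) (auto intro!: continuous_intros)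
  ultimately show ?thesis
    using leibniz_rule_field_derivative[of "{0..}" xL xR "\<lambda>s x. (f x s)^2"
        "\<lambda>s x. 2 * f x s * dt f x s" t] assms(3)
    by simp
qed

text \<open>Mean value theorem on \<open>{0..t}\<close>, to which the derivatives within
  \<open>{0..}\<close> restrict.\<close>

lemma nonincreasing_from_0:
  fixes f f' :: "real \<Rightarrow> real"
  assumes "\<And>t. t \<ge> 0 \<Longrightarrow> (f has_real_derivative f' t) (at t within {0..})"
    and "\<And>t. t \<ge> 0 \<Longrightarrow> f' t \<le> 0"
    and "t \<ge> 0"
  shows "f t \<le> f 0"
proof (cases "t = 0")
  case False
  then have "0 < t" using assms(3) by simp
  moreover have "(f has_derivative (*) (f' s)) (at s within {0..t})" if "0 \<le> s" "s \<le> t" for s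
    using assms(1)[OF that(1)] unfolding has_field_derivative_def
    by (rule has_derivative_subset) auto
  ultimately obtain s where s: "s \<in> {0<..<t}" "f t - f 0 = f' s * (t - 0)"
    using mvt_simple[of 0 t f "\<lambda>s. (*) (f' s)"] by blast
  moreover have "f' s * t \<le> 0"
    using assms(2)[of s] s(1) by (simp add: mult_nonpos_nonneg)
  ultimately show ?thesis by simp
qed simp

text \<open>In the coordinates \<open>q / (2 * H^2)\<close> and \<open>v\<close> the right-hand side
  is a quadratic form with symmetric matrix \<open>[[0, H^3/6], [H^3/6, -H*U/2]]\<close>. Its
  eigenvalues are \<open>lambda4\<close> and \<open>lambda5\<close>; the two squared terms are the
  coordinates along unit eigenvectors, with \<open>C_plus\<close> and \<open>C_minus\<close> as
  normalisations.\<close>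

lemma flux_diagonalisation:
  fixes H U q v :: real
  assumes "H > 0" "U > 0"
  defines "S \<equiv> S_const H U"
  shows "lambda4 H U * (1 / C_plus H U * (q - (3 * U + S) * v))^2
       + lambda5 H U * (1 / C_minus H U * (q - (3 * U - S) * v))^2
       = H * v * q / 6 - H * U / 2 * v^2"
proof -
  define a b where "a = 3 * U + S" and "b = 3 * U - S"
  have S2: "S^2 = 4 * H^4 + 9 * U^2"
    using assms by (simp add: S_def S_const_def)
  have S: "S > 0"
    using assms by (simp add: S_def S_const_def add_pos_pos)
  have a: "a > 0" using S assms by (simp add: a_def)
  \<comment> \<open>\<open>a\<close> and \<open>b\<close> are the roots of
    \<open>z^2 - 6 * U * z - 4 * H^4\<close>. Their product turns \<open>4 * H^4\<close> into
    \<open>- a * b\<close> below, and shows that \<open>b\<close> may be cancelled.\<close>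
  have ab: "a * b = - 4 * H^4"
    using S2 by (simp add: a_def b_def algebra_simps power2_eq_square)
  then have b: "b \<noteq> 0"
    using assms by auto
  have "(C_plus H U)^2 = 4 * H^4 + a^2" "(C_minus H U)^2 = 4 * H^4 + b^2"
    by (simp_all add: C_plus_def C_minus_def a_def b_def S_def)
  moreover have "4 * H^4 + a^2 = a * (a - b)" "4 * H^4 + b^2 = - b * (a - b)"
    using ab by (auto simp: algebra_simps power2_eq_square)
  ultimately have C: "(C_plus H U)^2 = 2 * a * S" "(C_minus H U)^2 = - 2 * b * S"
    by (auto simp: a_def b_def algebra_simps)
  have "lambda4 H U = - H / 12 * a" "lambda5 H U = - H / 12 * b"
    by (simp_all add: lambda4_def lambda5_def a_def b_def S_def field_simps)
  then have "lambda4 H U * (1 / C_plus H U * (q - a * v))^2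
       + lambda5 H U * (1 / C_minus H U * (q - b * v))^2
     = - H / 12 * a * (q - a * v)^2 / (2 * a * S) - H / 12 * b * (q - b * v)^2 / (- 2 * b * S)"
    using C by (simp add: power_mult_distrib power_divide)
  \<comment> \<open>The factors \<open>a\<close> and \<open>b\<close> of the eigenvalues cancel
    against those of the squared norms, leaving a difference of squares.\<close>
  also have "\<dots> = H / (24 * S) * ((q - b * v)^2 - (q - a * v)^2)"
    using a b S by (simp add: field_simps)
  also have "(q - b * v)^2 - (q - a * v)^2 = 2 * S * (v * (2 * q - 6 * U * v))"
    by (simp add: a_def b_def algebra_simps power2_eq_square)
  also have "H / (24 * S) * (2 * S * (v * (2 * q - 6 * U * v))) = H * v * q / 6 - H * U / 2 * v^2"
    using S by (simp add: field_simps power2_eq_square)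
  finally show ?thesis by (simp add: a_def b_def)
qed

text \<open>\<open>R\<close> is the diagonal matrix of \<open>lambda2\<close>,
  \<open>lambda3\<close>, \<open>lambda4\<close> plus \<open>lambda5\<close> times the rank-one
  matrix of the vector of the \<open>\<beta>\<close>s; the last square is thus \<open>w5^2\<close>
  under the condition at \<open>xR\<close>.\<close>

lemma R_matrix_quadratic_form:
  "vector [a, b, c] \<bullet> (R_matrix g H U \<beta>2 \<beta>3 \<beta>4 *v vector [a, b, c])
   = lambda2 H U * a^2 + lambda3 g U * b^2 + lambda4 H U * c^2
     + lambda5 H U * (\<beta>2 * a + \<beta>3 * b + \<beta>4 * c)^2"
  by (simp add: R_matrix_def Let_def inner_vec_def sum_3 matrix_vector_mult_def
      algebra_simps power2_eq_square)

definition flux ::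
  "real \<Rightarrow> real \<Rightarrow> real \<Rightarrow> real \<Rightarrow> real \<Rightarrow> (real \<Rightarrow> real \<Rightarrow> real) \<Rightarrow> (real \<Rightarrow> real \<Rightarrow> real)
     \<Rightarrow> real \<Rightarrow> real \<Rightarrow> real" where
  "flux g H U xL xR h u x t =
     - (g * U / 2) * (h x t)^2 - H^3 * U / 6 * (dx xL xR u x t)^2 - H * U / 2 * (u x t)^2
     + H / 6 * u x t * (2 * H^2 * U * dx xL xR (dx xL xR u) x t
                        + 2 * H^2 * dx xL xR (dt u) x t - 6 * g * h x t)"

lemma flux_eq:
  assumes "H > 0" "U > 0"
  shows "flux g H U xL xR h u x t =
      lambda2 H U * (w2 xL xR u x t)^2 + lambda3 g U * (w3 h x t)^2
    + lambda4 H U * (w4 g H U xL xR h u x t)^2 + lambda5 H U * (w5 g H U xL xR h u x t)^2"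
  using flux_diagonalisation[OF assms, of "2 * H^2 * U * dx xL xR (dx xL xR u) x t
      + 2 * H^2 * dx xL xR (dt u) x t - 6 * g * h x t" "u x t"]
  by (simp add: flux_def w2_def w3_def w4_def w5_def lambda2_def lambda3_def)

text \<open>After \<open>h_t\<close> and \<open>u_t\<close> are eliminated, the product rule matches
  all terms: the \<open>u_x^2\<close> part of the flux cancels the \<open>u_x u_xx\<close> left over
  from \<open>(u u_xx)_x\<close>, and \<open>(u u_xt)_x\<close> supplies \<open>u_x u_xt\<close>,
  the contribution of the \<open>u_x\<close> term of the energy.\<close>

lemma flux_has_derivative:
  assumes "xL < xR" "smooth_h xL xR h" "smooth_u xL xR u" "linearized_serre g H U xL xR h u"
    and x: "x \<in> {xL..xR}" and t: "t \<ge> 0"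
  shows "((\<lambda>y. flux g H U xL xR h u y t) has_real_derivative
            g * h x t * dt h x t + H * u x t * dt u x t
            + H^3 / 3 * dx xL xR u x t * dt (dx xL xR u) x t) (at x within {xL..xR})"
proof -
  let ?D = "dx xL xR"
  note [simp] = smooth_h_def smooth_u_def Let_def
  have *: "C_dx xL xR h" "C_dx xL xR u" "C_dx xL xR (?D u)" "C_dx xL xR (?D (?D u))"
    "C_dx xL xR (?D (dt u))"
    using assms by auto
  note d = *[THEN C_dx_has_derivative, OF x t]
  have "?D (\<lambda>x t. H * u x t + U * h x t) x t = H * ?D u x t + U * ?D h x t"
    by (rule dx_eqI[OF assms(1) x]) (auto intro!: derivative_eq_intros d)
  then have h_t: "dt h x t = - (H * ?D u x t + U * ?D h x t)"
    using assms(4) x t by (force simp: linearized_serre_def)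
  have "?D (\<lambda>x t. g * h x t + U * u x t - H^2 * U / 3 * ?D (?D u) x t
                    - H^2 / 3 * ?D (dt u) x t) x t
      = g * ?D h x t + U * ?D u x t - H^2 * U / 3 * ?D (?D (?D u)) x t
        - H^2 / 3 * ?D (?D (dt u)) x t"
    by (rule dx_eqI[OF assms(1) x]) (auto intro!: derivative_eq_intros d)
  then have u_t: "dt u x t = - (g * ?D h x t + U * ?D u x t - H^2 * U / 3 * ?D (?D (?D u)) x t
        - H^2 / 3 * ?D (?D (dt u)) x t)"
    using assms(4) x t by (force simp: linearized_serre_def)
  \<comment> \<open>The energy produces the time derivative of \<open>u_x\<close>, the flux the
    space derivative of \<open>u_t\<close>; commuting partials identify them.\<close>
  have u_xt: "dt (?D u) x t = ?D (dt u) x t"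
    using assms(3) x t by simp
  let ?q = "2 * H^2 * U * ?D (?D u) x t + 2 * H^2 * ?D (dt u) x t - 6 * g * h x t"
  have "((\<lambda>y. flux g H U xL xR h u y t) has_real_derivative
      - (g * U / 2) * (2 * h x t * ?D h x t) - H^3 * U / 6 * (2 * ?D u x t * ?D (?D u) x t)
      - H * U / 2 * (2 * u x t * ?D u x t)
      + (H / 6 * ?D u x t * ?q
         + H / 6 * u x t * (2 * H^2 * U * ?D (?D (?D u)) x t + 2 * H^2 * ?D (?D (dt u)) x t
                            - 6 * g * ?D h x t))) (at x within {xL..xR})"
    unfolding flux_def
    by (auto intro!: derivative_eq_intros d)
  then show ?thesis
    unfolding h_t u_t u_xt
    by (rule DERIV_cong) (simp add: field_simps power2_eq_square power3_eq_cube)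
qed

lemma energy_eq_integral:
  assumes "smooth_h xL xR h" "smooth_u xL xR u" "t \<ge> 0"
  shows "energy g H xL xR h u t =
      g / 2 * integral {xL..xR} (\<lambda>x. (h x t)^2) + H / 2 * integral {xL..xR} (\<lambda>x. (u x t)^2)
    + H^3 / 6 * integral {xL..xR} (\<lambda>x. (dx xL xR u x t)^2)"
  using assms
  by (simp add: energy_def smooth_h_def smooth_u_def Let_def C_dx_def L2_norm_on_squared
      cont_dom_continuous_on_x)

lemma energy_has_derivative:
  assumes "xL < xR" "smooth_h xL xR h" "smooth_u xL xR u" "linearized_serre g H U xL xR h u"
    and "t \<ge> 0"
  shows "((\<lambda>t. energy g H xL xR h u t) has_real_derivative
           flux g H U xL xR h u xR t - flux g H U xL xR h u xL t) (at t within {0..})"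
proof -
  let ?D = "dx xL xR" and ?I = "integral {xL..xR}"
  have c: "cont_dom xL xR h" "cont_dom xL xR u" "cont_dom xL xR (?D u)"
    and d: "C_dt xL xR h" "C_dt xL xR u" "C_dt xL xR (?D u)"
    using assms(2,3) by (simp_all add: smooth_h_def smooth_u_def Let_def C_dx_def)
  have i: "(\<lambda>x. 2 * k x t * dt k x t) integrable_on {xL..xR}"
    if "cont_dom xL xR k" "C_dt xL xR k" for k
    using that assms(5) unfolding C_dt_def
    by (intro integrable_continuous_real continuous_intros)
       (simp_all add: cont_dom_continuous_on_x)
  have "((\<lambda>x. g * h x t * dt h x t + H * u x t * dt u x t
            + H^3 / 3 * ?D u x t * dt (?D u) x t) has_integral
         flux g H U xL xR h u xR t - flux g H U xL xR h u xL t) {xL..xR}"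
    using assms
    by (intro fundamental_theorem_of_calculus)
       (auto simp flip: has_real_derivative_iff_has_vector_derivative
             simp del: times_divide_eq_left intro: flux_has_derivative)
  \<comment> \<open>The same integrand, grouped as the Leibniz rule delivers it; uniqueness of the
    integral then equates the two values.\<close>
  moreover have "((\<lambda>x. g / 2 * (2 * h x t * dt h x t) + H / 2 * (2 * u x t * dt u x t)
            + H^3 / 6 * (2 * ?D u x t * dt (?D u) x t)) has_integral
         g / 2 * ?I (\<lambda>x. 2 * h x t * dt h x t) + H / 2 * ?I (\<lambda>x. 2 * u x t * dt u x t)
            + H^3 / 6 * ?I (\<lambda>x. 2 * ?D u x t * dt (?D u) x t)) {xL..xR}"
    by (intro has_integral_add has_integral_mult_right integrable_integral i c d)
  ultimately have eq: "g / 2 * ?I (\<lambda>x. 2 * h x t * dt h x t)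
            + H / 2 * ?I (\<lambda>x. 2 * u x t * dt u x t)
            + H^3 / 6 * ?I (\<lambda>x. 2 * ?D u x t * dt (?D u) x t)
      = flux g H U xL xR h u xR t - flux g H U xL xR h u xL t"
    by (intro has_integral_unique[rotated]) (simp_all add: algebra_simps)
  have "((\<lambda>s. g / 2 * ?I (\<lambda>x. (h x s)^2) + H / 2 * ?I (\<lambda>x. (u x s)^2)
            + H^3 / 6 * ?I (\<lambda>x. (?D u x s)^2)) has_real_derivative
          flux g H U xL xR h u xR t - flux g H U xL xR h u xL t) (at t within {0..})"
    unfolding eq[symmetric]
    by (intro DERIV_add DERIV_cmult integral_square_has_derivative c d assms)
  then show ?thesis
    \<comment> \<open>The integral formula for the energy holds for \<open>t \<ge> 0\<close>, which
      is exactly the set within which the derivative is taken; the radius 1 is arbitrary.\<close>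
    by (rule has_field_derivative_transform_within[OF _ zero_less_one])
       (use assms in \<open>auto simp: energy_eq_integral\<close>)
qed

theorem theorem3:
  fixes g H U xL xR :: real
    and h u :: "real \<Rightarrow> real \<Rightarrow> real"
    and f_h f_u :: "real \<Rightarrow> real"
    and \<alpha>2 \<alpha>3 \<alpha>4 \<beta>2 \<beta>3 \<beta>4 :: real
  assumes "g > 0" and "H > 0" and "U > 0" and "xL < xR"
    and "smooth_h xL xR h" and "smooth_u xL xR u"
    and "linearized_serre g H U xL xR h u"
    and "Ck_compact_support 1 f_h" and "Ck_compact_support 3 f_u"
    and "\<And>x. x \<in> {xL..xR} \<Longrightarrow> h x 0 = f_h x"
    and "\<And>x. x \<in> {xL..xR} \<Longrightarrow> u x 0 = f_u x"
    and "\<And>t. t \<ge> 0 \<Longrightarrow> w2 xL xR u xL t = \<alpha>2 * w5 g H U xL xR h u xL t"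
    and "\<And>t. t \<ge> 0 \<Longrightarrow> w3 h xL t = \<alpha>3 * w5 g H U xL xR h u xL t"
    and "\<And>t. t \<ge> 0 \<Longrightarrow> w4 g H U xL xR h u xL t = \<alpha>4 * w5 g H U xL xR h u xL t"
    and "\<And>t. t \<ge> 0 \<Longrightarrow> w5 g H U xL xR h u xR t =
           \<beta>2 * w2 xL xR u xR t + \<beta>3 * w3 h xR t + \<beta>4 * w4 g H U xL xR h u xR t"
    and "\<And>v :: real^3. v \<bullet> (R_matrix g H U \<beta>2 \<beta>3 \<beta>4 *v v) \<le> 0"
    and "lambda2 H U * \<alpha>2^2 + lambda3 g U * \<alpha>3^2 + lambda4 H U * \<alpha>4^2 + lambda5 H U \<ge> 0"
  shows "\<forall>t\<ge>0. energy g H xL xR h u t \<le> energy g H xL xR h u 0"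
proof -
  have nonpos: "flux g H U xL xR h u xR t - flux g H U xL xR h u xL t \<le> 0" if t: "t \<ge> 0" for t
  proof -
    have "flux g H U xL xR h u xR t \<le> 0"
      using assms(16)[of "vector [w2 xL xR u xR t, w3 h xR t, w4 g H U xL xR h u xR t]"]
      unfolding R_matrix_quadratic_form flux_eq[OF assms(2,3)] assms(15)[OF t] by simp
    moreover have "flux g H U xL xR h u xL t =
        (lambda2 H U * \<alpha>2^2 + lambda3 g U * \<alpha>3^2 + lambda4 H U * \<alpha>4^2 + lambda5 H U)
          * (w5 g H U xL xR h u xL t)^2"
      \<comment> \<open>At \<open>xL\<close> every variable is a multiple of \<open>w5\<close>, so
        the diagonal form collapses to one square.\<close>
      unfolding flux_eq[OF assms(2,3)] assms(12-14)[OF t] by (simp add: algebra_simps)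
    then have "flux g H U xL xR h u xL t \<ge> 0"
      using assms(17) by simp
    ultimately show ?thesis by simp
  qed
  show ?thesis
    using nonincreasing_from_0[OF energy_has_derivative[OF assms(4-7)] nonpos] by blast
qed

end
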